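(* Let $T$ be a rooted tree with $n$ vertices. Then $$|\lambda|\le(n-1)\,l_{\max}(T)$$ for every eigenvalue $\lambda$ of $L(T)$. Equality holds for $n\le 2$.
   Context: A rooted tree is a finite tree with a distinguished vertex (the root). The level $l(v)$ of a vertex $v$ is its distance from the root, and $l_{\max}(T)$ is the maximum level of a vertex of $T$. For a rooted tree $T$ with vertices $v_1,\dots,v_n$, the level matrix $L(T)=(l_{ij})$ is the $n\times n$ real symmetric matrix with $l_{ij}=|l(v_i)-l(v_j)|$. *)

theory Defs
  imports "Graph_Theory.Graph_Theory" "Jordan_Normal_Form.Char_Poly"
begin

text \<open>A finite simple undirected graph is a \<^locale>\<open>pair_graph\<close>: each edge is a pair of
  opposite arcs. The library predicate \<^const>\<open>tree\<close> is not the undirected notion: on such a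
  graph, traversing one edge back and forth already is a \<^const>\<open>pre_digraph.cycle\<close>, so
  every edge would be excluded. Genuine cycles are those of length at least 3.\<close>

locale rooted_tree = pair_graph T for T :: "'a pair_pre_digraph" +
  fixes r :: 'a
  assumes root_in_verts: "r \<in> pverts T"
    and connected: "Digraph_Component.connected (with_proj T)"
    and acyclic: "\<nexists>p. cycle p \<and> 3 \<le> length p"

text \<open>The distance is the library's shortest-path cost \<^const>\<open>wf_digraph.\<mu>\<close>, with unit
  arc weights. It is finite between any two vertices of a tree.\<close>

definition level :: "'a pair_pre_digraph \<Rightarrow> 'a \<Rightarrow> 'a \<Rightarrow> real" where
  "level T r v = real_of_ereal (wf_digraph.\<mu> (with_proj T) (\<lambda>_. 1) r v)"

lemma (in rooted_tree) level_eq_shortest_walk: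
  assumes "v \<in> pverts T"
  shows "level T r v = real (LEAST k. \<exists>p. awalk r p v \<and> length p = k)"
proof -
  have c: "awalk_cost (\<lambda>_. 1) p = real (length p)" for p :: "('a \<times> 'a) list"
    by (induct p) auto
  have "strongly_connected (with_proj T)"
    by (intro symmetric_connected_imp_strongly_connected connected sym_arcs)
  then have "r \<rightarrow>\<^sup>*\<^bsub>with_proj T\<^esub> v"
    using assms root_in_verts by (auto simp: strongly_connected_def)
  then obtain p where p: "apath r p v" and m: "\<mu> (\<lambda>_. 1) r v = awalk_cost (\<lambda>_. 1) p"
    using min_cost_awalk[of r v "\<lambda>_. 1"] by auto
  have aw: "awalk r p v" using p by (simp add: apath_def)
  have "length p \<le> length q" if "awalk r q v" for q
    using min_cost_le_walk_cost[OF that, of "\<lambda>_. 1"] m by (simp add: c)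
  then have "(LEAST k. \<exists>p. awalk r p v \<and> length p = k) = length p"
    using aw by (intro Least_equality) auto
  then show ?thesis by (simp add: level_def m c)
qed

definition l_max :: "'a pair_pre_digraph \<Rightarrow> 'a \<Rightarrow> real" where
  "l_max T r = Max (level T r ` pverts T)"

text \<open>The list \<open>vs\<close> is the enumeration of the vertices.\<close>

definition level_matrix :: "'a pair_pre_digraph \<Rightarrow> 'a \<Rightarrow> 'a list \<Rightarrow> real mat" where
  "level_matrix T r vs =
     mat (length vs) (length vs) (\<lambda>(i, j). \<bar>level T r (vs ! i) - level T r (vs ! j)\<bar>)"

end

theory Submission
  imports Defs
begin

text \<open>The diagonal of the level matrix vanishes, and every other entry is the distance of two
  numbers in the interval \<open>[0, l_max T r]\<close>, so it is at most \<open>l_max T r\<close>. Each row therefore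
  has absolute sum at most \<open>(n - 1) * l_max T r\<close>, and comparing the eigenvalue equation at a
  coordinate of largest modulus of an eigenvector gives the bound, as for Gershgorin discs
  (\<open>abs_eigenvalue_le_zero_diagonal\<close>).

  For \<open>n = 1\<close> both sides are 0. For \<open>n = 2\<close> one vertex is the root, of level 0, so the
  level of the other one is \<open>l_max T r\<close>. The matrix has zero diagonal and off-diagonal
  entries \<open>l_max T r\<close>, hence its eigenvalues are \<open>\<plusminus> l_max T r\<close>
  (\<open>abs_eigenvalue_two_by_two\<close>).\<close>

lemma eigenvalue_coordinates:
  fixes A :: "real mat"
  assumes "A \<in> carrier_mat n n" and "eigenvalue A ev"
  obtains v where "v \<in> carrier_vec n" and "\<exists>i<n. v $ i \<noteq> 0"
    and "\<And>i. i < n \<Longrightarrow> ev * v $ i = (\<Sum>j<n. A $$ (i, j) * v $ j)"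
proof -
  obtain v where v: "v \<in> carrier_vec n" "v \<noteq> 0\<^sub>v n" "A *\<^sub>v v = ev \<cdot>\<^sub>v v"
    using assms by (auto simp: eigenvalue_def eigenvector_def)
  have nz: "\<exists>i<n. v $ i \<noteq> 0"
    using v(1,2) by (metis carrier_vecD eq_vecI index_zero_vec)
  have "ev * v $ i = (\<Sum>j<n. A $$ (i, j) * v $ j)" if "i < n" for i
  proof -
    have "ev * v $ i = (A *\<^sub>v v) $ i"
      using v that by simp
    also have "\<dots> = (\<Sum>j<n. A $$ (i, j) * v $ j)"
      using assms(1) v(1) that by (auto simp: scalar_prod_def lessThan_atLeast0)
    finally show ?thesis .
  qed
  with v(1) nz show thesis by (rule that)
qed

text \<open>Row \<open>i\<close> of the eigenvalue equation, at an index \<open>i\<close> where the eigenvector has largest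
  modulus: the zero diagonal leaves \<open>n - 1\<close> terms, each at most \<open>c\<close> times that modulus.\<close>

lemma abs_eigenvalue_le_zero_diagonal:
  fixes A :: "real mat"
  assumes A: "A \<in> carrier_mat n n" and ev: "eigenvalue A ev"
    and diag: "\<And>i. i < n \<Longrightarrow> A $$ (i, i) = 0"
    and entries: "\<And>i j. i < n \<Longrightarrow> j < n \<Longrightarrow> \<bar>A $$ (i, j)\<bar> \<le> c"
  shows "\<bar>ev\<bar> \<le> (real n - 1) * c"
proof -
  obtain v where nz: "\<exists>i<n. v $ i \<noteq> 0"
    and eq: "\<And>i. i < n \<Longrightarrow> ev * v $ i = (\<Sum>j<n. A $$ (i, j) * v $ j)"
    using eigenvalue_coordinates[OF A ev] by metis
  let ?M = "Max ((\<lambda>j. \<bar>v $ j\<bar>) ` {..<n})"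
  from nz have "?M \<in> (\<lambda>j. \<bar>v $ j\<bar>) ` {..<n}"
    by (intro Max_in) auto
  then obtain i where i: "i < n" "\<bar>v $ i\<bar> = ?M" by auto
  then have max: "\<bar>v $ j\<bar> \<le> \<bar>v $ i\<bar>" if "j < n" for j
    using that by simp
  have pos: "0 < \<bar>v $ i\<bar>"
    using nz max by (metis abs_ge_zero abs_le_zero_iff less_eq_real_def)
  have "\<bar>ev\<bar> * \<bar>v $ i\<bar> = \<bar>\<Sum>j<n. A $$ (i, j) * v $ j\<bar>"
    using eq[OF i(1)] by (simp flip: abs_mult)
  also have "\<dots> = \<bar>\<Sum>j\<in>{..<n} - {i}. A $$ (i, j) * v $ j\<bar>"
    using i(1) diag by (simp add: sum.remove[of "{..<n}" i])
  also have "\<dots> \<le> (\<Sum>j\<in>{..<n} - {i}. \<bar>A $$ (i, j)\<bar> * \<bar>v $ j\<bar>)"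
    unfolding abs_mult[symmetric] by (rule sum_abs)
  also have "\<dots> \<le> (\<Sum>j\<in>{..<n} - {i}. c * \<bar>v $ i\<bar>)"
  proof (rule sum_mono)
    fix j assume "j \<in> {..<n} - {i}"
    then have "\<bar>A $$ (i, j)\<bar> \<le> c" and "\<bar>v $ j\<bar> \<le> \<bar>v $ i\<bar>"
      using entries i(1) max by auto
    then show "\<bar>A $$ (i, j)\<bar> * \<bar>v $ j\<bar> \<le> c * \<bar>v $ i\<bar>"
      by (intro mult_mono) auto
  qed
  also have "\<dots> = ((real n - 1) * c) * \<bar>v $ i\<bar>"
    using i(1) by (simp add: of_nat_diff)
  finally show ?thesis
    using pos by simp
qed

text \<open>The eigenvalue equation swaps the two coordinates up to the factor \<open>a\<close>. Applying it twice
  gives \<open>ev\<^sup>2 = a\<^sup>2\<close>.\<close>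

lemma abs_eigenvalue_two_by_two:
  fixes A :: "real mat"
  assumes A: "A \<in> carrier_mat 2 2" and ev: "eigenvalue A ev"
    and diag: "A $$ (0, 0) = 0" "A $$ (1, 1) = 0"
    and off: "A $$ (0, 1) = a" "A $$ (1, 0) = a"
  shows "\<bar>ev\<bar> = \<bar>a\<bar>"
proof -
  obtain v where nz: "\<exists>i<2. v $ i \<noteq> 0"
    and eq: "\<And>i. i < 2 \<Longrightarrow> ev * v $ i = (\<Sum>j<2. A $$ (i, j) * v $ j)"
    using eigenvalue_coordinates[OF A ev] by metis
  have e: "ev * v $ 0 = a * v $ 1" "ev * v $ 1 = a * v $ 0"
    using eq[of 0] eq[of 1] diag off by (simp_all add: numeral_2_eq_2)
  have "ev\<^sup>2 * v $ 0 = a * (ev * v $ 1)" "ev\<^sup>2 * v $ 1 = a * (ev * v $ 0)"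
    by (simp_all only: power2_eq_square mult.assoc e mult.left_commute[of ev a])
  then have "ev\<^sup>2 * v $ 0 = a\<^sup>2 * v $ 0" "ev\<^sup>2 * v $ 1 = a\<^sup>2 * v $ 1"
    by (simp_all only: e power2_eq_square mult.assoc)
  moreover have "v $ 0 \<noteq> 0 \<or> v $ 1 \<noteq> 0"
    using nz less_2_cases by auto
  ultimately have "ev\<^sup>2 = a\<^sup>2" by auto
  then show ?thesis by (simp add: power2_eq_iff abs_eq_iff)
qed

context rooted_tree
begin

lemma level_nonneg: "v \<in> pverts T \<Longrightarrow> 0 \<le> level T r v"
  by (simp add: level_eq_shortest_walk)

lemma level_root: "level T r r = 0"
proof -
  have "awalk r [] r" using root_in_verts by (simp add: awalk_Nil_iff)
  then have "(LEAST k. \<exists>p. awalk r p r \<and> length p = k) = 0"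
    by (intro Least_equality) auto
  then show ?thesis using level_eq_shortest_walk[OF root_in_verts] by simp
qed

lemma level_le_l_max: "v \<in> pverts T \<Longrightarrow> level T r v \<le> l_max T r"
  by (simp add: l_max_def)

lemma abs_level_diff_le_l_max:
  assumes "u \<in> pverts T" "v \<in> pverts T"
  shows "\<bar>level T r u - level T r v\<bar> \<le> l_max T r"
  using assms[THEN level_nonneg] assms[THEN level_le_l_max] by linarith

lemma abs_level_diff_two_vertices:
  assumes "pverts T = {u, v}"
  shows "\<bar>level T r u - level T r v\<bar> = l_max T r"
proof -
  have "l_max T r = max (level T r u) (level T r v)"
    using assms by (simp add: l_max_def)
  moreover have "0 \<le> level T r u" "0 \<le> level T r v"
    using assms level_nonneg by auto
  moreover have "level T r u = 0 \<or> level T r v = 0"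
    using assms root_in_verts level_root by auto
  ultimately show ?thesis by auto
qed

end

theorem proposition1:
  fixes T :: "'a pair_pre_digraph" and r :: 'a and vs :: "'a list" and n :: nat
  assumes "rooted_tree T r"
    and "card (pverts T) = n"
    and "distinct vs" and "set vs = pverts T"
  shows "(\<forall>ev. eigenvalue (level_matrix T r vs) ev \<longrightarrow> \<bar>ev\<bar> \<le> (real n - 1) * l_max T r) \<and>
         (n \<le> 2 \<longrightarrow>
           (\<forall>ev. eigenvalue (level_matrix T r vs) ev \<longrightarrow> \<bar>ev\<bar> = (real n - 1) * l_max T r))"
proof -
  interpret rooted_tree T r by fact
  let ?L = "level_matrix T r vs"
  have len: "length vs = n"
    using assms(2-4) distinct_card by metis
  have L: "?L \<in> carrier_mat n n"
    by (simp add: level_matrix_def len)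
  have entry: "?L $$ (i, j) = \<bar>level T r (vs ! i) - level T r (vs ! j)\<bar>"
    if "i < n" "j < n" for i j
    using that by (simp add: level_matrix_def len)
  have vert: "vs ! i \<in> pverts T" if "i < n" for i
    using that assms(4) len nth_mem by metis
  have bound: "\<bar>ev\<bar> \<le> (real n - 1) * l_max T r" if "eigenvalue ?L ev" for ev
    using L that
    by (rule abs_eigenvalue_le_zero_diagonal)
      (simp_all add: entry vert abs_level_diff_le_l_max)
  have "\<bar>ev\<bar> = (real n - 1) * l_max T r" if "n \<le> 2" and ev: "eigenvalue ?L ev" for ev
  proof -
    have "vs \<noteq> []"
      using assms(4) root_in_verts by auto
    then have "n \<noteq> 0"
      using len by auto
    with \<open>n \<le> 2\<close> consider "n = 1" | "n = 2" by linarith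
    then show ?thesis
    proof cases
      case 1
      then show ?thesis using bound[OF ev] by simp
    next
      case 2
      then have "vs = [vs ! 0, vs ! 1]"
        using len by (auto simp: numeral_2_eq_2 length_Suc_conv)
      then have "pverts T = {vs ! 0, vs ! 1}"
        using assms(4) by (metis list.simps(15) list.set(1))
      note diff = abs_level_diff_two_vertices[OF this]
      have "\<bar>ev\<bar> = \<bar>l_max T r\<bar>"
        using 2 L ev diff
        by (intro abs_eigenvalue_two_by_two[of ?L]) (simp_all add: entry abs_minus_commute)
      also have "\<dots> = l_max T r"
        using diff by linarith
      finally show ?thesis using 2 by simp
    qed
  qed
  with bound show ?thesis by blast
qed

end
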